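(* For every positive integer $C$ there exists a value distribution $F=F_1\times F_2$ that is additive over $2$ independent, regular (not identically distributed) items such that $$\mathrm{Rev}(\mathrm{VCG},F,C+1)<\sum_{j=1}^2\mathbb E_{v\sim F}\Big[\varphi_j(v_j)^+\cdot\mathbb I_{A_j}+v_j\cdot\mathbb I_{\bar A_j}\Big],$$ where $A_j$ is the event that $v_j>v_{j'}$ for the other item $j'\neq j$, and $\bar A_j$ is its complement (ties broken lexicographically). The right-hand side is the benchmark of Cai et al. for one bidder with valuation drawn from $F$.
   Context: There are two items; a draw $v=(v_1,v_2)\sim F=F_1\times F_2$ has independent coordinates and an additive bidder's value for a set $S$ is $\sum_{j\in S}v_j$. Each $F_j$ is a distribution on $[0,\infty)$ (identified with its CDF) with a density $f_j$ positive on an interval, except that an atom is allowed at the maximum $b$ of the support. The virtual value function is $\varphi_j(x)=x-\frac{1-F_j(x)}{f_j(x)}$ where the density exists, with $\varphi_j(b)=b$ at an atom at the maximum $b$; $F_j$ is regular if $\varphi_j$ is non-decreasing. Write $y^+=\max\{y,0\}$. $\mathrm{Rev}(\mathrm{VCG},F,k)$ is the expected revenue of the VCG mechanism with $k$ additive bidders with valuations i.i.d. from $F$, i.e. the sum over items $j$ of the expected second-highest of $k$ i.i.d. draws from $F_j$ (zero if $k=1$). *)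

theory Defs
  imports "HOL-Probability.Probability"
begin

text \<open>
  \<open>F\<close> is the law of the value of one item: density \<open>f\<close>, positive on \<open>(a, b)\<close>, and no mass elsewhere
  except possibly an atom at \<open>b\<close>. Here \<open>0 \<le> a < b\<close>, and \<open>b = \<infinity>\<close> (no atom) is allowed. The density is
  carried as data because the virtual value refers to it pointwise, while \<open>F\<close> determines it only
  almost everywhere.
\<close>

definition item_distribution :: "real measure \<Rightarrow> (real \<Rightarrow> real) \<Rightarrow> real \<Rightarrow> ereal \<Rightarrow> bool" where
  "item_distribution F f a b \<longleftrightarrow>
     prob_space F \<and> sets F = sets borel \<and> 0 \<le> a \<and> ereal a < b \<and>
     f \<in> borel_measurable borel \<and>
     (\<forall>x. a < x \<and> ereal x < b \<longrightarrow> 0 < f x) \<and>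
     (\<forall>B\<in>sets borel. (\<forall>x\<in>B. ereal x \<noteq> b) \<longrightarrow>
        emeasure F B = (\<integral>\<^sup>+x\<in>B \<inter> {x. a < x \<and> ereal x < b}. ennreal (f x) \<partial>lborel))"

text \<open>For an \<^const>\<open>item_distribution\<close>, the only possible atom is the maximum of the support.\<close>

definition virtual_value :: "real measure \<Rightarrow> (real \<Rightarrow> real) \<Rightarrow> real \<Rightarrow> real" where
  "virtual_value F f x = (if measure F {x} > 0 then x else x - (1 - cdf F x) / f x)"

text \<open>
  If \<open>b\<close> is finite, then \<open>cdf F b = 1\<close>, so the virtual value at \<open>b\<close> is \<open>b\<close> even without an atom. The
  left endpoint \<open>a\<close> is a null set where the density need not have a positive value.
\<close>

definition regular_item :: "real measure \<Rightarrow> (real \<Rightarrow> real) \<Rightarrow> bool" where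
  "regular_item F f \<longleftrightarrow>
     (\<exists>a b. item_distribution F f a b \<and>
            mono_on {x. a < x \<and> ereal x \<le> b} (virtual_value F f))"

definition second_highest :: "nat \<Rightarrow> (nat \<Rightarrow> real) \<Rightarrow> real" where
  "second_highest k x = (if k < 2 then 0 else sort (map x [0..<k]) ! (k - 2))"

text \<open>
  Expectations are taken in \<^typ>\<open>ennreal\<close>, so that they are meaningful without integrability
  assumptions; all integrands are almost surely nonnegative.
\<close>

definition vcg_revenue :: "nat set \<Rightarrow> (nat \<Rightarrow> real measure) \<Rightarrow> nat \<Rightarrow> ennreal" where
  "vcg_revenue J F k =
     (\<Sum>j\<in>J. \<integral>\<^sup>+x. ennreal (second_highest k x) \<partial>(\<Pi>\<^sub>M i\<in>{..<k}. F j))"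

text \<open>The event that item \<open>j\<close> has the highest value, ties being won by the smallest index.\<close>

definition favorite :: "nat set \<Rightarrow> nat \<Rightarrow> (nat \<Rightarrow> real) set" where
  "favorite J j = {v. \<forall>i\<in>J - {j}. v j > v i \<or> (v j = v i \<and> j < i)}"

definition benchmark :: "nat set \<Rightarrow> (nat \<Rightarrow> real measure) \<Rightarrow> (nat \<Rightarrow> real \<Rightarrow> real) \<Rightarrow> ennreal" where
  "benchmark J F f =
     (\<Sum>j\<in>J. \<integral>\<^sup>+v. ennreal (max (virtual_value (F j) (f j) (v j)) 0 * indicator (favorite J j) v
                          + v j * indicator (- favorite J j) v) \<partial>(\<Pi>\<^sub>M j\<in>J. F j))"

end

(*
  Item 1 has the equal-revenue law P(v > x) = 1/x: its virtual value vanishes identically and its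
  mean is infinite, while the second highest of k draws has finite mean, at most 2^k. Item 2 is
  uniform on [H, H + 1], so it is the favorite whenever v_1 < H, and the benchmark then collects the
  whole value of item 1, worth ln H on average. On item 2 both integrands are at least the virtual
  value 2 v_2 - H - 1 >= H - 1, whereas VCG earns at most H + 1. So the benchmark wins once
  ln H > 2^k + 2.
*)

theory Submission
  imports Defs "HOL-Real_Asymp.Real_Asymp"
begin

section \<open>Atomless laws with a density on an open interval\<close>

definition interval_law :: "(real \<Rightarrow> real) \<Rightarrow> real \<Rightarrow> ereal \<Rightarrow> real measure" where
  "interval_law f a b = density lborel (\<lambda>x. ennreal (f x) * indicator {x. a < x \<and> ereal x < b} x)"

lemma sets_interval_law [simp, measurable_cong]: "sets (interval_law f a b) = sets borel"
  and space_interval_law [simp]: "space (interval_law f a b) = UNIV"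
  by (simp_all add: interval_law_def)

lemma nn_integral_interval_law:
  assumes [measurable]: "f \<in> borel_measurable borel" "g \<in> borel_measurable borel"
  shows "(\<integral>\<^sup>+x. g x \<partial>interval_law f a b) =
    (\<integral>\<^sup>+x. ennreal (f x) * g x * indicator {x. a < x \<and> ereal x < b} x \<partial>lborel)"
  unfolding interval_law_def by (subst nn_integral_density) (auto simp: ac_simps)

lemma emeasure_interval_law:
  assumes [measurable]: "f \<in> borel_measurable borel" "B \<in> sets borel"
  shows "emeasure (interval_law f a b) B =
    (\<integral>\<^sup>+x\<in>B \<inter> {x. a < x \<and> ereal x < b}. ennreal (f x) \<partial>lborel)"
  unfolding interval_law_def
  by (subst emeasure_density) (auto intro!: nn_integral_cong simp: indicator_def)

text \<open>Null singletons put \<open>virtual_value\<close> into its density branch at every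
  point.\<close>

lemma emeasure_interval_law_singleton:
  assumes "f \<in> borel_measurable borel"
  shows "emeasure (interval_law f a b) {x} = 0"
proof -
  have "(\<integral>\<^sup>+y\<in>{x} \<inter> {x. a < x \<and> ereal x < b}. ennreal (f y) \<partial>lborel) = (\<integral>\<^sup>+y. 0 \<partial>(lborel :: real measure))"
    by (rule nn_integral_cong_AE, rule AE_I[where N = "{x}"]) (auto simp: indicator_def)
  then show ?thesis using assms by (simp add: emeasure_interval_law)
qed

lemma item_distribution_interval_law:
  assumes "f \<in> borel_measurable borel" "prob_space (interval_law f a b)"
    and "0 \<le> a" "ereal a < b" "\<And>x. a < x \<Longrightarrow> ereal x < b \<Longrightarrow> 0 < f x"
  shows "item_distribution (interval_law f a b) f a b"
  using assms by (auto simp: item_distribution_def emeasure_interval_law)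

lemma virtual_value_interval_law:
  assumes "f \<in> borel_measurable borel"
  shows "virtual_value (interval_law f a b) f x = x - (1 - cdf (interval_law f a b) x) / f x"
  using assms by (simp add: virtual_value_def measure_def emeasure_interval_law_singleton)

section \<open>The equal-revenue law\<close>

abbreviation equal_revenue :: "real measure" where
  "equal_revenue \<equiv> interval_law (\<lambda>x. 1 / x\<^sup>2) 1 \<infinity>"

lemma prob_space_equal_revenue: "prob_space equal_revenue"
proof
  have "(\<integral>\<^sup>+x. ennreal (1 / x\<^sup>2) * indicator {1 ..} x \<partial>lborel) = ennreal (0 - (- 1 / 1))"
  proof (rule nn_integral_FTC_atLeast[where F = "\<lambda>x. - 1 / x"])
    show "((\<lambda>x::real. - 1 / x) \<longlongrightarrow> 0) at_top" by real_asymp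
  qed (auto intro!: derivative_eq_intros simp: power2_eq_square)
  \<comment> \<open>The fundamental theorem integrates over a closed half-line; the support is open
    at 1, which changes the set by a null set only.\<close>
  moreover have "(\<integral>\<^sup>+x\<in>{x. 1 < x}. ennreal (1 / x\<^sup>2) \<partial>lborel)
      = (\<integral>\<^sup>+x. ennreal (1 / x\<^sup>2) * indicator {1 ..} x \<partial>(lborel :: real measure))"
    by (rule nn_integral_cong_AE, rule AE_I[where N = "{1}"]) (auto simp: indicator_def)
  ultimately show "emeasure equal_revenue (space equal_revenue) = 1"
    by (simp add: emeasure_interval_law)
qed

lemma cdf_equal_revenue:
  assumes "1 \<le> x"
  shows "cdf equal_revenue x = 1 - 1 / x"
proof -
  have "(\<integral>\<^sup>+y. ennreal (1 / y\<^sup>2) * indicator {1 .. x} y \<partial>lborel) = ennreal (- 1 / x - (- 1 / 1))"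
    by (rule nn_integral_FTC_Icc[where F = "\<lambda>x. - 1 / x"])
      (use assms in \<open>auto intro!: derivative_eq_intros simp: power2_eq_square\<close>)
  moreover have "(\<integral>\<^sup>+y\<in>{..x} \<inter> {y. 1 < y}. ennreal (1 / y\<^sup>2) \<partial>lborel)
      = (\<integral>\<^sup>+y. ennreal (1 / y\<^sup>2) * indicator {1 .. x} y \<partial>(lborel :: real measure))"
    by (rule nn_integral_cong_AE, rule AE_I[where N = "{1}"]) (auto simp: indicator_def)
  ultimately show ?thesis using assms
    by (simp add: cdf_def measure_def emeasure_interval_law)
qed

text \<open>The survival function 1/x divided by the density 1/x^2 is x, which cancels the value
  itself.\<close>

lemma virtual_value_equal_revenue:
  assumes "1 < x"
  shows "virtual_value equal_revenue (\<lambda>x. 1 / x\<^sup>2) x = 0"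
  using assms
  by (simp add: virtual_value_interval_law cdf_equal_revenue)
    (simp add: power2_eq_square)

lemma regular_item_equal_revenue: "regular_item equal_revenue (\<lambda>x. 1 / x\<^sup>2)"
  unfolding regular_item_def
  by (intro exI[of _ 1] exI[of _ \<infinity>] conjI item_distribution_interval_law prob_space_equal_revenue)
    (auto simp: mono_on_def virtual_value_equal_revenue)

text \<open>The value has infinite mean, but its square root is integrable, and this integral is the
  factor that one bidder contributes to the revenue bound. On the support the \<open>max\<close> is
  inert.\<close>

lemma nn_integral_sqrt_equal_revenue: "(\<integral>\<^sup>+x. ennreal (sqrt (max 1 x)) \<partial>equal_revenue) = 2"
proof -
  have "(\<integral>\<^sup>+x. ennreal (sqrt x / x\<^sup>2) * indicator {1 ..} x \<partial>lborel) = ennreal (0 - (- 2 / sqrt 1))"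
  proof (rule nn_integral_FTC_atLeast[where F = "\<lambda>x. - 2 / sqrt x"])
    show "((\<lambda>x::real. - 2 / sqrt x) \<longlongrightarrow> 0) at_top" by real_asymp
    fix x :: real assume "1 \<le> x"
    \<comment> \<open>This reduces the derivative to algebra in \<open>sqrt x\<close>.\<close>
    moreover have "x = sqrt x * sqrt x" using \<open>1 \<le> x\<close> by simp
    ultimately show "((\<lambda>x. - 2 / sqrt x) has_real_derivative sqrt x / x\<^sup>2) (at x)"
      by (auto intro!: derivative_eq_intros simp: field_simps power2_eq_square)
  qed auto
  moreover have "(\<integral>\<^sup>+x. ennreal (1 / x\<^sup>2) * ennreal (sqrt (max 1 x)) * indicator {x. 1 < x} x \<partial>lborel)
      = (\<integral>\<^sup>+x. ennreal (sqrt x / x\<^sup>2) * indicator {1 ..} x \<partial>lborel)"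
    by (rule nn_integral_cong_AE, rule AE_I[where N = "{1}"])
      (auto simp: indicator_def max_def simp flip: ennreal_mult split: if_splits)
  ultimately show ?thesis by (simp add: nn_integral_interval_law)
qed

text \<open>Value times density is 1/x, whence the logarithm. The cutoff \<open>H\<close> is where
  the support of item 2 starts, so item 1 surely loses below it.\<close>

lemma nn_integral_equal_revenue_truncated:
  assumes "1 \<le> H"
  shows "(\<integral>\<^sup>+x. ennreal x * indicator {1<..<H} x \<partial>equal_revenue) = ennreal (ln H)"
proof -
  have "(\<integral>\<^sup>+x. ennreal (1 / x) * indicator {1 .. H} x \<partial>lborel) = ennreal (ln H - ln 1)"
    by (rule nn_integral_FTC_Icc[where F = ln])
      (use assms in \<open>auto intro!: derivative_eq_intros\<close>)
  moreover have "(\<integral>\<^sup>+x. ennreal (1 / x\<^sup>2) * (ennreal x * indicator {1<..<H} x) * indicator {x. 1 < x} x \<partial>lborel)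
      = (\<integral>\<^sup>+x. ennreal (1 / x) * indicator {1 .. H} x \<partial>lborel)"
    by (rule nn_integral_cong_AE, rule AE_I[where N = "{1, H}"])
      (auto simp: indicator_def power2_eq_square simp flip: ennreal_mult split: if_splits
        intro: emeasure_lborel_countable)
  ultimately show ?thesis using assms by (simp add: nn_integral_interval_law)
qed

section \<open>The uniform law on a unit interval\<close>

abbreviation unit_uniform :: "real \<Rightarrow> real measure" where
  "unit_uniform H \<equiv> interval_law (\<lambda>_. 1) H (ereal (H + 1))"

lemma emeasure_unit_uniform:
  assumes "B \<in> sets borel"
  shows "emeasure (unit_uniform H) B = emeasure lborel (B \<inter> {H<..<H + 1})"
proof -
  have "{x. H < x \<and> x < H + 1} = {H<..<H + 1}" by auto
  then show ?thesis using assms by (simp add: emeasure_interval_law)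
qed

lemma prob_space_unit_uniform: "prob_space (unit_uniform H)"
  by standard (simp add: emeasure_unit_uniform)

lemma cdf_unit_uniform:
  assumes "H \<le> x" "x \<le> H + 1"
  shows "cdf (unit_uniform H) x = x - H"
proof -
  \<comment> \<open>The two sets differ only if \<open>x = H + 1\<close>, and then only in that
    endpoint.\<close>
  have "emeasure lborel ({..x} \<inter> {H<..<H + 1}) = emeasure lborel {H<..x}"
    by (rule emeasure_eq_AE, rule AE_I[where N = "{H + 1}"]) (use assms in auto)
  then show ?thesis using assms by (simp add: cdf_def measure_def emeasure_unit_uniform)
qed

text \<open>The endpoint \<open>x = H + 1\<close> is included because regularity tests monotonicity
  up to and including \<open>b\<close>.\<close>

lemma virtual_value_unit_uniform:
  assumes "H \<le> x" "x \<le> H + 1"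
  shows "virtual_value (unit_uniform H) (\<lambda>_. 1) x = 2 * x - (H + 1)"
  using assms by (simp add: virtual_value_interval_law cdf_unit_uniform)

lemma regular_item_unit_uniform:
  assumes "0 \<le> H"
  shows "regular_item (unit_uniform H) (\<lambda>_. 1)"
  unfolding regular_item_def
  by (intro exI[of _ H] exI[of _ "ereal (H + 1)"] conjI item_distribution_interval_law
      prob_space_unit_uniform)
    (use assms in \<open>auto simp: mono_on_def virtual_value_unit_uniform\<close>)

section \<open>Bounds on the expected second-highest draw\<close>

text \<open>
  Pointwise in \<open>x\<close> and multiplicative over the coordinates, this bound turns the expectation of an
  order statistic into a power of a one-dimensional integral. Two factors are at least
  \<open>sqrt (s / c)\<close>, where \<open>s\<close> is the second highest value, and the others are at least \<open>1\<close>.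
\<close>

lemma second_highest_le_prod:
  assumes "0 < c"
  shows "second_highest k x \<le> c * (\<Prod>i<k. sqrt (max 1 (x i / c)))"
proof (cases "k < 2")
  case True
  then show ?thesis using assms by (simp add: second_highest_def prod_nonneg)
next
  case False
  define g where "g y = sqrt (max 1 (y / c))" for y
  have g1: "1 \<le> g y" for y by (simp add: g_def)
  define xs where "xs = sort (map x [0..<k])"
  define s where "s = xs ! (k - 2)"
  define t where "t = xs ! (k - 1)"
  have len: "length xs = k" by (simp add: xs_def)
  have "s \<le> t"
    unfolding s_def t_def by (rule sorted_nth_mono) (use False len in \<open>auto simp: xs_def\<close>)
  \<comment> \<open>Splitting off the two largest entries separates their factors from the rest of
    the product.\<close>
  have "drop (k - 2) xs = s # drop (Suc (k - 2)) xs"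
    unfolding s_def by (rule Cons_nth_drop_Suc[symmetric]) (use False len in auto)
  also have "Suc (k - 2) = k - 1" using False by simp
  also have "drop (k - 1) xs = t # drop (Suc (k - 1)) xs"
    unfolding t_def by (rule Cons_nth_drop_Suc[symmetric]) (use False len in auto)
  finally have xs: "xs = take (k - 2) xs @ [s, t]"
    using append_take_drop_id[of "k - 2" xs] False len by simp
  have ge1: "1 \<le> prod_list (map g ys)" for ys
  proof (induction ys)
    case (Cons y ys)
    then show ?case using mult_mono[of 1 "g y" 1 "prod_list (map g ys)"] g1[of y] by simp
  qed simp
  \<comment> \<open>The \<open>max\<close> covers small or negative \<open>s\<close> too; squaring
    then undoes the root in \<open>g\<close>.\<close>
  have "s / c \<le> max 1 (s / c)" by simp
  also have "\<dots> = g s * g s" by (simp add: g_def)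
  also have "\<dots> \<le> g s * g t"
    using \<open>s \<le> t\<close> assms g1[of s]
    by (intro mult_left_mono) (auto simp: g_def le_max_iff_disj divide_right_mono)
  also have "\<dots> \<le> prod_list (map g (take (k - 2) xs)) * (g s * g t)"
    using ge1[of "take (k - 2) xs"] g1[of s] mult_mono[of 1 "g s" 1 "g t"] g1[of s] g1[of t]
    by (simp add: mult_le_cancel_right1)
  also have "\<dots> = prod_list (map g xs)" by (subst (2) xs) simp
  \<comment> \<open>Passing to multisets forgets the sorting and leads back to the product over the
    bidders.\<close>
  also have "\<dots> = prod_mset (image_mset g (mset xs))" by (simp add: prod_mset_prod_list flip: mset_map)
  also have "mset xs = mset (map x [0..<k])" by (simp add: xs_def)
  also have "prod_mset (image_mset g \<dots>) = prod_list (map (\<lambda>i. g (x i)) [0..<k])"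
    by (simp add: prod_mset_prod_list comp_def flip: mset_map)
  also have "\<dots> = (\<Prod>i<k. g (x i))" by (simp add: prod.list_conv_set_nth atLeast0LessThan)
  finally show ?thesis
    using False assms by (simp add: second_highest_def g_def s_def xs_def field_simps)
qed

text \<open>Independence factors the expectation of the product into \<open>k\<close> equal
  integrals. The scale \<open>c\<close> stays free so that each law can use its own.\<close>

lemma nn_integral_second_highest_le:
  assumes "prob_space M" and [measurable_cong]: "sets M = sets borel" and "0 < c"
  shows "(\<integral>\<^sup>+x. ennreal (second_highest k x) \<partial>(\<Pi>\<^sub>M i\<in>{..<k}. M)) \<le>
    ennreal c * (\<integral>\<^sup>+y. ennreal (sqrt (max 1 (y / c))) \<partial>M) ^ k"
proof -
  interpret prob_space M by fact
  interpret product_sigma_finite "\<lambda>_::nat. M" by standard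
  have "(\<integral>\<^sup>+x. ennreal (second_highest k x) \<partial>(\<Pi>\<^sub>M i\<in>{..<k}. M)) \<le>
      (\<integral>\<^sup>+x. ennreal c * (\<Prod>i<k. ennreal (sqrt (max 1 (x i / c)))) \<partial>(\<Pi>\<^sub>M i\<in>{..<k}. M))"
  proof (rule nn_integral_mono)
    fix x
    have "(\<Prod>i<k. ennreal (sqrt (max 1 (x i / c)))) = ennreal (\<Prod>i<k. sqrt (max 1 (x i / c)))"
      by (rule prod_ennreal) simp
    then show "ennreal (second_highest k x) \<le> ennreal c * (\<Prod>i<k. ennreal (sqrt (max 1 (x i / c))))"
      using second_highest_le_prod[OF \<open>0 < c\<close>, of k x] \<open>0 < c\<close>
      by (simp add: ennreal_leI prod_nonneg flip: ennreal_mult)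
  qed
  also have "\<dots> = ennreal c * (\<integral>\<^sup>+x. (\<Prod>i<k. ennreal (sqrt (max 1 (x i / c)))) \<partial>(\<Pi>\<^sub>M i\<in>{..<k}. M))"
    by (rule nn_integral_cmult) measurable
  also have "(\<integral>\<^sup>+x. (\<Prod>i<k. ennreal (sqrt (max 1 (x i / c)))) \<partial>(\<Pi>\<^sub>M i\<in>{..<k}. M)) =
      (\<integral>\<^sup>+y. ennreal (sqrt (max 1 (y / c))) \<partial>M) ^ k"
    by (subst product_nn_integral_prod) auto
  finally show ?thesis .
qed

text \<open>Scaling by the upper endpoint keeps every ratio on the support below 1, so the resulting
  revenue bound does not grow with \<open>k\<close>.\<close>

lemma nn_integral_unit_uniform_bounded:
  assumes "0 \<le> H"
  shows "(\<integral>\<^sup>+y. ennreal (sqrt (max 1 (y / (H + 1)))) \<partial>unit_uniform H) = 1"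
proof -
  have "(\<integral>\<^sup>+y. ennreal (sqrt (max 1 (y / (H + 1)))) \<partial>unit_uniform H) =
      (\<integral>\<^sup>+y. indicator {H<..<H + 1} y \<partial>lborel)"
    using assms by (auto simp: nn_integral_interval_law indicator_def max_def intro!: nn_integral_cong)
  then show ?thesis by simp
qed

section \<open>Revenue and benchmark of the two-item instance\<close>

lemma vcg_revenue_equal_revenue_unit_uniform_le:
  assumes "0 \<le> H" "F 1 = equal_revenue" "F 2 = unit_uniform H"
  shows "vcg_revenue {1, 2} F k \<le> ennreal (2 ^ k + (H + 1))"
proof -
  \<comment> \<open>With scale 1 each of the \<open>k\<close> draws contributes the integral 2,
    whatever \<open>H\<close> is.\<close>
  have "(\<integral>\<^sup>+x. ennreal (second_highest k x) \<partial>(\<Pi>\<^sub>M i\<in>{..<k}. equal_revenue)) \<le> ennreal (2 ^ k)"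
    using nn_integral_second_highest_le[OF prob_space_equal_revenue, where c = 1 and k = k]
    by (simp add: nn_integral_sqrt_equal_revenue flip: ennreal_power)
  moreover have "(\<integral>\<^sup>+x. ennreal (second_highest k x) \<partial>(\<Pi>\<^sub>M i\<in>{..<k}. unit_uniform H)) \<le> ennreal (H + 1)"
    using nn_integral_second_highest_le[OF prob_space_unit_uniform[of H], where c = "H + 1" and k = k] assms(1)
    by (simp add: nn_integral_unit_uniform_bounded)
  ultimately show ?thesis
    using assms by (simp add: vcg_revenue_def ennreal_plus add_mono)
qed

text \<open>Each integrand is bounded below by a function of \<open>v 1\<close> times a function of
  \<open>v 2\<close>, whose integral is a product of one-dimensional integrals.\<close>

lemma benchmark_equal_revenue_unit_uniform_ge:
  assumes "1 \<le> H" "F 1 = equal_revenue" "F 2 = unit_uniform H" "f 2 = (\<lambda>_. 1)"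
  shows "ennreal (ln H + (H - 1)) \<le> benchmark {1, 2} F f"
proof -
  \<comment> \<open>\<open>F\<close> is constrained only at 1 and 2; \<open>G\<close> agrees with it
    there and is a probability measure at every index, as the product locale demands.\<close>
  define G where "G = (\<lambda>i::nat. if i = 1 then equal_revenue else unit_uniform H)"
  have PiM: "(\<Pi>\<^sub>M j\<in>{1, 2}. F j) = (\<Pi>\<^sub>M j\<in>{1, 2}. G j)"
    using assms by (intro PiM_cong) (auto simp: G_def)
  have "prob_space (G i)" for i
    by (simp add: G_def prob_space_equal_revenue prob_space_unit_uniform)
  then interpret product_prob_space G "{1, 2}"
    by (auto simp: product_prob_space_def product_prob_space_axioms_def product_sigma_finite_def
        intro: prob_space_imp_sigma_finite)
  let ?u = "indicator {H<..<H + 1} :: real \<Rightarrow> ennreal"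
  let ?I = "\<lambda>j v. ennreal (max (virtual_value (F j) (f j) (v j)) 0 * indicator (favorite {1, 2} j) v
                          + v j * indicator (- favorite {1, 2} j) v)"
  have prod2: "(\<integral>\<^sup>+v. g (v 1) * h (v 2) \<partial>(\<Pi>\<^sub>M j\<in>{1, 2}. F j)) =
      (\<integral>\<^sup>+x. g x \<partial>equal_revenue) * (\<integral>\<^sup>+x. h x \<partial>unit_uniform H)"
    if [measurable]: "g \<in> borel_measurable borel" "h \<in> borel_measurable borel"
    for g h :: "real \<Rightarrow> ennreal"
  proof -
    have "(\<integral>\<^sup>+v. (\<Prod>i\<in>{1, 2}. (if i = 1 then g else h) (v i)) \<partial>(\<Pi>\<^sub>M j\<in>{1, 2}. G j)) =
        (\<Prod>i\<in>{1, 2}. \<integral>\<^sup>+x. (if i = 1 then g else h) x \<partial>G i)"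
      by (rule product_nn_integral_prod) (auto simp: G_def)
    then show ?thesis unfolding PiM by (simp add: G_def)
  qed
  have "ennreal (ln H) = (\<integral>\<^sup>+v. ennreal (v 1) * indicator {1<..<H} (v 1) * ?u (v 2) \<partial>(\<Pi>\<^sub>M j\<in>{1, 2}. F j))"
    using prod2[of "\<lambda>x. ennreal x * indicator {1<..<H} x" ?u] assms(1)
    by (simp add: nn_integral_equal_revenue_truncated emeasure_unit_uniform)
  \<comment> \<open>Where \<open>v 1 < H < v 2\<close>, item 1 is not the favorite and contributes
    \<open>v 1\<close>; off the rectangle the left side vanishes.\<close>
  also have "\<dots> \<le> (\<integral>\<^sup>+v. ?I 1 v \<partial>(\<Pi>\<^sub>M j\<in>{1, 2}. F j))"
    by (rule nn_integral_mono) (auto simp: indicator_def favorite_def)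
  finally have 1: "ennreal (ln H) \<le> (\<integral>\<^sup>+v. ?I 1 v \<partial>(\<Pi>\<^sub>M j\<in>{1, 2}. F j))" .
  have "ennreal (H - 1) = (\<integral>\<^sup>+v. 1 * (ennreal (H - 1) * ?u (v 2)) \<partial>(\<Pi>\<^sub>M j\<in>{1, 2}. F j))"
    using prod2[of "\<lambda>_. 1" "\<lambda>x. ennreal (H - 1) * ?u x"]
      prob_space.emeasure_space_1[OF prob_space_equal_revenue]
    by (simp add: nn_integral_cmult emeasure_unit_uniform)
  \<comment> \<open>For \<open>v 2 > H\<close> the favorite case gives
    \<open>2 * v 2 - (H + 1) > H - 1\<close>, and the other case gives \<open>v 2\<close> itself,
    which is larger still.\<close>
  also have "\<dots> \<le> (\<integral>\<^sup>+v. ?I 2 v \<partial>(\<Pi>\<^sub>M j\<in>{1, 2}. F j))"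
    by (rule nn_integral_mono)
      (use assms in \<open>auto simp: indicator_def virtual_value_unit_uniform intro!: ennreal_leI\<close>)
  finally have "ennreal (H - 1) \<le> (\<integral>\<^sup>+v. ?I 2 v \<partial>(\<Pi>\<^sub>M j\<in>{1, 2}. F j))" .
  with 1 have "ennreal (ln H) + ennreal (H - 1) \<le> benchmark {1, 2} F f"
    unfolding benchmark_def by (simp add: add_mono)
  then show ?thesis using assms(1) by (simp add: ennreal_plus)
qed

theorem proposition3p3:
  fixes C :: nat
  assumes "C \<ge> 1"
  shows "\<exists>(F :: nat \<Rightarrow> real measure) (f :: nat \<Rightarrow> real \<Rightarrow> real).
           (\<forall>j\<in>{1, 2}. regular_item (F j) (f j)) \<and> F 1 \<noteq> F 2 \<and>
           vcg_revenue {1, 2} F (C + 1) < benchmark {1, 2} F f"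
proof -
  \<comment> \<open>In the final comparison \<open>H\<close> cancels and
    \<open>ln H > 2 ^ (C + 1) + 2\<close> remains; the 3 leaves a slack of 1.\<close>
  define H :: real where "H = exp (2 ^ (C + 1) + 3)"
  have "exp 0 < H" unfolding H_def by (subst exp_less_cancel_iff) (simp add: add_pos_pos)
  then have H: "1 < H" by simp
  define F where "F j = (if j = 1 then equal_revenue else unit_uniform H)" for j :: nat
  define f :: "nat \<Rightarrow> real \<Rightarrow> real" where "f j = (if j = 1 then \<lambda>x. 1 / x\<^sup>2 else (\<lambda>_. 1))" for j
  have "\<forall>j\<in>{1, 2}. regular_item (F j) (f j)"
    using H by (auto simp: F_def f_def regular_item_equal_revenue regular_item_unit_uniform)
  moreover have "F 1 \<noteq> F 2"
  proof
    assume "F 1 = F 2"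
    \<comment> \<open>At \<open>H\<close> the uniform law has accumulated no mass, the equal-revenue
      law the positive mass \<open>1 - 1 / H\<close>.\<close>
    then have "cdf equal_revenue H = cdf (unit_uniform H) H" by (simp add: F_def)
    then show False using H by (simp add: cdf_equal_revenue cdf_unit_uniform)
  qed
  moreover have "vcg_revenue {1, 2} F (C + 1) < benchmark {1, 2} F f"
  proof -
    have "vcg_revenue {1, 2} F (C + 1) \<le> ennreal (2 ^ (C + 1) + (H + 1))"
      using H by (intro vcg_revenue_equal_revenue_unit_uniform_le) (auto simp: F_def)
    also have "\<dots> < ennreal (ln H + (H - 1))"
      using H by (intro ennreal_lessI) (auto simp: H_def add_pos_pos)
    also have "\<dots> \<le> benchmark {1, 2} F f"
      using H by (intro benchmark_equal_revenue_unit_uniform_ge) (auto simp: F_def f_def)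
    finally show ?thesis .
  qed
  ultimately show ?thesis by blast
qed

end
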